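(* The free product $\prod^*_{i\in I}G_i$ of a family $\{G_i: i\in I\}$ of nonidentity groups is a group of finite $C$-width if and only if $|I|=2$ and both groups participating in the free product are of order two.
   Context: A nonidentity group is a group with more than one element. For a group $G$ and a generating set $S$ of $G$, the length $|g|_S$ of $g\in G$ is the least number of elements of $S\cup S^{-1}$ whose product is $g$; the width of $G$ relative to $S$ is $\mathrm{wid}(G,S)=\sup\{|g|_S: g\in G\}$. A generating set $S$ of $G$ is conjugation-invariant if it is invariant under all conjugations (inner automorphisms) of $G$, i.e. $gSg^{-1}=S$ for all $g\in G$. The group $G$ is a group of finite $C$-width if $\mathrm{wid}(G,S)<\infty$ for every conjugation-invariant generating set $S$ of $G$.
   Formalization: The family is assumed to have at least two members, since for one factor of order two (or the empty family) the free product is finite, hence of finite C-width, although |I| is not 2. *)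

theory Defs
  imports "HOL-Algebra.Algebra" "HOL-Library.Extended_Nat"
begin

section \<open>Free products of groups\<close>

text \<open>
  The free product of the groups \<open>G i\<close>, \<open>i \<in> I\<close>, is realised on normal forms. A letter \<open>(i, g)\<close>
  stands for the element \<open>g\<close> of the factor \<open>G i\<close>; tagging with \<open>i\<close> keeps the factors disjoint although
  they share an element type. A word is reduced if none of its letters is an identity element and
  neighbouring letters come from different factors.
\<close>

definition reduced_words :: "'i set \<Rightarrow> ('i \<Rightarrow> ('a, 'b) monoid_scheme) \<Rightarrow> ('i \<times> 'a) list set" where
  "reduced_words I G =
     {w. set w \<subseteq> (SIGMA i:I. carrier (G i) - {\<one>\<^bsub>G i\<^esub>}) \<and> successively (\<lambda>x y. fst x \<noteq> fst y) w}"

text \<open>The normal form of a letter (possibly an identity element) times a reduced word.\<close>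

fun letter_mult ::
    "('i \<Rightarrow> ('a, 'b) monoid_scheme) \<Rightarrow> 'i \<times> 'a \<Rightarrow> ('i \<times> 'a) list \<Rightarrow> ('i \<times> 'a) list" where
  "letter_mult G (i, g) [] = (if g = \<one>\<^bsub>G i\<^esub> then [] else [(i, g)])"
| "letter_mult G (i, g) ((j, h) # w) =
     (if g = \<one>\<^bsub>G i\<^esub> then (j, h) # w
      else if i \<noteq> j then (i, g) # (j, h) # w
      else if g \<otimes>\<^bsub>G i\<^esub> h = \<one>\<^bsub>G i\<^esub> then w
      else (i, g \<otimes>\<^bsub>G i\<^esub> h) # w)"

definition free_product ::
    "'i set \<Rightarrow> ('i \<Rightarrow> ('a, 'b) monoid_scheme) \<Rightarrow> ('i \<times> 'a) list monoid" where
  "free_product I G =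
     \<lparr>carrier = reduced_words I G, monoid.mult = (\<lambda>u v. foldr (letter_mult G) u v), one = []\<rparr>"

definition free_product_inj ::
    "('i \<Rightarrow> ('a, 'b) monoid_scheme) \<Rightarrow> 'i \<Rightarrow> 'a \<Rightarrow> ('i \<times> 'a) list" where
  "free_product_inj G i g = letter_mult G (i, g) []"

context
  fixes I :: "'i set" and G :: "'i \<Rightarrow> ('a, 'b) monoid_scheme"
  assumes groups: "\<And>i. i \<in> I \<Longrightarrow> group (G i)"
begin

lemma reduced_words_Nil: "[] \<in> reduced_words I G"
  by (simp add: reduced_words_def)

lemma reduced_words_Cons:
  "(i, g) # w \<in> reduced_words I G \<longleftrightarrow>
     i \<in> I \<and> g \<in> carrier (G i) \<and> g \<noteq> \<one>\<^bsub>G i\<^esub> \<and> w \<in> reduced_words I G \<and> (w = [] \<or> fst (hd w) \<noteq> i)"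
  by (cases w) (auto simp: reduced_words_def)

lemma letter_mult_closed:
  assumes "i \<in> I" "g \<in> carrier (G i)" "w \<in> reduced_words I G"
  shows "letter_mult G (i, g) w \<in> reduced_words I G"
proof -
  interpret group "G i" by (rule groups[OF assms(1)])
  show ?thesis
    using assms by (cases w) (auto simp: reduced_words_Cons reduced_words_Nil)
qed

lemma letter_mult_letter_mult:
  assumes "i \<in> I" "g \<in> carrier (G i)" "h \<in> carrier (G i)" "w \<in> reduced_words I G"
  shows "letter_mult G (i, g) (letter_mult G (i, h) w) = letter_mult G (i, g \<otimes>\<^bsub>G i\<^esub> h) w"
proof -
  interpret group "G i" by (rule groups[OF assms(1)])
  show ?thesis
  proof (cases w)
    case Nil
    then show ?thesis using assms by auto
  next
    case (Cons x v)
    obtain j k where x: "x = (j, k)" by (cases x)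
    show ?thesis
    proof (cases "i = j")
      case False
      then show ?thesis using assms Cons x by auto
    next
      case True
      have k: "k \<in> carrier (G i)" "k \<noteq> \<one>\<^bsub>G i\<^esub>" and v: "v = [] \<or> fst (hd v) \<noteq> i"
        using assms Cons x True by (auto simp: reduced_words_Cons)
      have v': "letter_mult G (i, y) v = (if y = \<one>\<^bsub>G i\<^esub> then v else (i, y) # v)" for y
        using v by (cases v) auto
      have step: "letter_mult G (i, y) w = letter_mult G (i, y \<otimes>\<^bsub>G i\<^esub> k) v"
        if "y \<in> carrier (G i)" for y
        using that k Cons x True[symmetric] unfolding v' by auto
      have "letter_mult G (i, g) (letter_mult G (i, y) v) = letter_mult G (i, g \<otimes>\<^bsub>G i\<^esub> y) v"
        if "y \<in> carrier (G i)" for y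
        using that assms(2) unfolding v' by (auto simp: v')
      then show ?thesis
        using step assms k by (simp add: m_assoc)
    qed
  qed
qed

lemma foldr_letter_mult_closed:
  assumes "u \<in> reduced_words I G" "v \<in> reduced_words I G"
  shows "foldr (letter_mult G) u v \<in> reduced_words I G"
  using assms by (induction u) (auto simp: reduced_words_Cons intro: letter_mult_closed)

lemma foldr_letter_mult:
  assumes "i \<in> I" "g \<in> carrier (G i)" "u \<in> reduced_words I G" "v \<in> reduced_words I G"
  shows "foldr (letter_mult G) (letter_mult G (i, g) u) v =
         letter_mult G (i, g) (foldr (letter_mult G) u v)"
proof -
  interpret group "G i" by (rule groups[OF assms(1)])
  have one: "letter_mult G (i, \<one>\<^bsub>G i\<^esub>) z = z" for z :: "('i \<times> 'a) list"
    by (cases z) auto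
  show ?thesis
  proof (cases u)
    case Nil
    then show ?thesis using one by auto
  next
    case (Cons x w)
    obtain j k where x: "x = (j, k)" by (cases x)
    have "k \<in> carrier (G j)" and w: "foldr (letter_mult G) w v \<in> reduced_words I G"
      using assms Cons x by (auto simp: reduced_words_Cons intro: foldr_letter_mult_closed)
    then show ?thesis
      using assms Cons x one letter_mult_letter_mult[OF assms(1,2) _ w] by auto
  qed
qed

lemma foldr_letter_mult_Nil: "u \<in> reduced_words I G \<Longrightarrow> foldr (letter_mult G) u [] = u"
proof (induction u)
  case (Cons x u)
  then show ?case by (cases x; cases u) (auto simp: reduced_words_Cons)
qed simp

theorem group_free_product: "group (free_product I G)"
proof (rule groupI)
  fix u assume "u \<in> carrier (free_product I G)"
  then have "u \<in> reduced_words I G" by (simp add: free_product_def)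
  then have "\<exists>v\<in>reduced_words I G. foldr (letter_mult G) v u = []"
  proof (induction u)
    case Nil
    then show ?case using reduced_words_Nil by force
  next
    case (Cons x u)
    obtain i g where x: "x = (i, g)" by (cases x)
    with Cons.prems have i: "i \<in> I" "g \<in> carrier (G i)" "g \<noteq> \<one>\<^bsub>G i\<^esub>" and u: "u \<in> reduced_words I G"
      by (auto simp: reduced_words_Cons)
    interpret group "G i" by (rule groups[OF i(1)])
    from Cons.IH[OF u] obtain v where v: "v \<in> reduced_words I G" "foldr (letter_mult G) v u = []"
      by auto
    let ?y = "[(i, inv\<^bsub>G i\<^esub> g)]"
    have y: "?y \<in> reduced_words I G"
      using i by (simp add: reduced_words_Cons reduced_words_Nil inv_eq_1_iff)
    have yxu: "foldr (letter_mult G) ?y (x # u) = u"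
      using i x by (simp add: inv_eq_1_iff)
    have "foldr (letter_mult G) (foldr (letter_mult G) v ?y) (x # u) =
          foldr (letter_mult G) v (foldr (letter_mult G) ?y (x # u))"
      using v(1)
    proof (induction v)
      case (Cons z v)
      then show ?case
        using Cons.prems foldr_letter_mult foldr_letter_mult_closed y \<open>x # u \<in> reduced_words I G\<close>
        by (cases z) (auto simp: reduced_words_Cons simp del: letter_mult.simps)
    qed simp
    with yxu v show ?case
      using foldr_letter_mult_closed[OF v(1) y] by (metis (no_types))
  qed
  then show "\<exists>v\<in>carrier (free_product I G). v \<otimes>\<^bsub>free_product I G\<^esub> u = \<one>\<^bsub>free_product I G\<^esub>"
    by (simp add: free_product_def)
next
  fix u v w
  assume "u \<in> carrier (free_product I G)" "v \<in> carrier (free_product I G)"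
    "w \<in> carrier (free_product I G)"
  then have "u \<in> reduced_words I G" and v: "v \<in> reduced_words I G" and w: "w \<in> reduced_words I G"
    by (auto simp: free_product_def)
  then have "foldr (letter_mult G) (foldr (letter_mult G) u v) w =
             foldr (letter_mult G) u (foldr (letter_mult G) v w)"
  proof (induction u)
    case (Cons z u)
    then show ?case
      using foldr_letter_mult[OF _ _ foldr_letter_mult_closed]
      by (cases z) (auto simp: reduced_words_Cons)
  qed simp
  then show "u \<otimes>\<^bsub>free_product I G\<^esub> v \<otimes>\<^bsub>free_product I G\<^esub> w =
             u \<otimes>\<^bsub>free_product I G\<^esub> (v \<otimes>\<^bsub>free_product I G\<^esub> w)"
    by (simp add: free_product_def)
qed (auto simp: free_product_def reduced_words_Nil foldr_letter_mult_closed)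

theorem free_product_inj_hom:
  assumes "i \<in> I"
  shows "free_product_inj G i \<in> hom (G i) (free_product I G)"
proof -
  have "foldr (letter_mult G) (letter_mult G (i, g) []) (letter_mult G (i, h) []) =
        letter_mult G (i, g \<otimes>\<^bsub>G i\<^esub> h) []"
    if "g \<in> carrier (G i)" "h \<in> carrier (G i)" for g h
    using foldr_letter_mult[OF assms that(1) reduced_words_Nil
        letter_mult_closed[OF assms that(2) reduced_words_Nil]]
      letter_mult_letter_mult[OF assms that reduced_words_Nil]
    by simp
  then show ?thesis
    using letter_mult_closed[OF assms _ reduced_words_Nil]
    by (auto simp: hom_def free_product_def free_product_inj_def simp del: letter_mult.simps)
qed

theorem free_product_universal:
  assumes H: "group H" and \<phi>: "\<And>i. i \<in> I \<Longrightarrow> \<phi> i \<in> hom (G i) H"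
  shows "\<exists>!\<psi>. \<psi> \<in> hom (free_product I G) H \<inter> extensional (carrier (free_product I G)) \<and>
              (\<forall>i\<in>I. \<forall>g\<in>carrier (G i). \<psi> (free_product_inj G i g) = \<phi> i g)"
proof -
  interpret H: group H by (rule H)
  define ev where "ev w = foldr (\<lambda>(i, g) y. \<phi> i g \<otimes>\<^bsub>H\<^esub> y) w \<one>\<^bsub>H\<^esub>" for w
  have cl: "\<phi> i g \<in> carrier H" if "i \<in> I" "g \<in> carrier (G i)" for i g
    using \<phi>[OF that(1)] that(2) by (auto simp: hom_def)
  have one: "\<phi> i \<one>\<^bsub>G i\<^esub> = \<one>\<^bsub>H\<^esub>" if "i \<in> I" for i
    using hom_one[OF \<phi> groups H] that by auto
  have mul: "\<phi> i (g \<otimes>\<^bsub>G i\<^esub> h) = \<phi> i g \<otimes>\<^bsub>H\<^esub> \<phi> i h"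
    if "i \<in> I" "g \<in> carrier (G i)" "h \<in> carrier (G i)" for i g h
    using hom_mult[OF \<phi>[OF that(1)]] that by auto
  have ev_cl: "ev w \<in> carrier H" if "w \<in> reduced_words I G" for w
    using that by (induction w) (auto simp: ev_def reduced_words_Cons cl)
  have ev_letter: "ev (letter_mult G (i, g) w) = \<phi> i g \<otimes>\<^bsub>H\<^esub> ev w"
    if i: "i \<in> I" "g \<in> carrier (G i)" and w: "w \<in> reduced_words I G" for i g w
  proof (cases w)
    case Nil
    then show ?thesis using i by (auto simp: ev_def one cl)
  next
    case (Cons x v)
    obtain j k where x: "x = (j, k)" by (cases x)
    have k: "j \<in> I" "k \<in> carrier (G j)" and v: "ev v \<in> carrier H"
      using w Cons x ev_cl by (auto simp: reduced_words_Cons)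
    have ev_Cons: "ev ((j', y) # v) = \<phi> j' y \<otimes>\<^bsub>H\<^esub> ev v" for j' y by (simp add: ev_def)
    have ev_Cons2: "ev ((i, g) # (j, k) # v) = \<phi> i g \<otimes>\<^bsub>H\<^esub> (\<phi> j k \<otimes>\<^bsub>H\<^esub> ev v)" by (simp add: ev_def)
    have "\<phi> i g \<otimes>\<^bsub>H\<^esub> (\<phi> j k \<otimes>\<^bsub>H\<^esub> ev v) = \<phi> i (g \<otimes>\<^bsub>G i\<^esub> k) \<otimes>\<^bsub>H\<^esub> ev v" if "i = j"
      using that i k v cl mul by (simp add: H.m_assoc)
    then show ?thesis
      using Cons x i k v one cl by (auto simp: ev_Cons ev_Cons2)
  qed
  have ev_mult: "ev (foldr (letter_mult G) u v) = ev u \<otimes>\<^bsub>H\<^esub> ev v"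
    if "u \<in> reduced_words I G" and v: "v \<in> reduced_words I G" for u v
    using that(1)
  proof (induction u)
    case Nil
    then show ?case using ev_cl[OF v] by (simp add: ev_def)
  next
    case (Cons x u)
    obtain i g where x: "x = (i, g)" by (cases x)
    have i: "i \<in> I" "g \<in> carrier (G i)" and u: "u \<in> reduced_words I G"
      using Cons.prems x by (auto simp: reduced_words_Cons)
    have "ev (x # u) = \<phi> i g \<otimes>\<^bsub>H\<^esub> ev u" by (simp add: ev_def x)
    then show ?case
      using Cons.IH[OF u] ev_letter[OF i foldr_letter_mult_closed[OF u v]] x
      by (simp add: H.m_assoc cl[OF i] ev_cl[OF u] ev_cl[OF v])
  qed
  have ev_inj: "ev (free_product_inj G i g) = \<phi> i g" if "i \<in> I" "g \<in> carrier (G i)" for i g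
    using ev_letter[OF that reduced_words_Nil] cl[OF that]
    by (simp add: free_product_inj_def ev_def del: letter_mult.simps)
  let ?\<psi> = "restrict ev (carrier (free_product I G))"
  have inj_cl: "free_product_inj G i g \<in> carrier (free_product I G)"
    if "i \<in> I" "g \<in> carrier (G i)" for i g
    using free_product_inj_hom[OF that(1)] that(2) by (auto simp: hom_def)
  show ?thesis
  proof (rule ex1I[of _ ?\<psi>])
    show "?\<psi> \<in> hom (free_product I G) H \<inter> extensional (carrier (free_product I G)) \<and>
          (\<forall>i\<in>I. \<forall>g\<in>carrier (G i). ?\<psi> (free_product_inj G i g) = \<phi> i g)"
      using ev_inj inj_cl ev_cl ev_mult foldr_letter_mult_closed
      by (auto simp: hom_def free_product_def)
  next
    fix \<psi> assume \<psi>: "\<psi> \<in> hom (free_product I G) H \<inter> extensional (carrier (free_product I G)) \<and>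
          (\<forall>i\<in>I. \<forall>g\<in>carrier (G i). \<psi> (free_product_inj G i g) = \<phi> i g)"
    have "\<psi> w = ev w" if "w \<in> reduced_words I G" for w
      using that
    proof (induction w)
      case Nil
      have "\<psi> [] = \<one>\<^bsub>H\<^esub>"
        using \<psi> hom_one[OF _ group_free_product H, of \<psi>] by (simp add: free_product_def)
      then show ?case by (simp add: ev_def)
    next
      case (Cons x w)
      obtain i g where x: "x = (i, g)" by (cases x)
      have i: "i \<in> I" "g \<in> carrier (G i)" "g \<noteq> \<one>\<^bsub>G i\<^esub>" and w: "w \<in> reduced_words I G"
        using Cons.prems x by (auto simp: reduced_words_Cons)
      have "x # w = free_product_inj G i g \<otimes>\<^bsub>free_product I G\<^esub> w"
        using foldr_letter_mult_Nil[OF Cons.prems] foldr_letter_mult_Nil[OF w] i x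
        by (simp add: free_product_inj_def free_product_def)
      then have "\<psi> (x # w) = \<psi> (free_product_inj G i g) \<otimes>\<^bsub>H\<^esub> \<psi> w"
        using \<psi> inj_cl[OF i(1,2)] w by (auto simp: hom_def free_product_def)
      then show ?case
        using \<psi> i Cons.IH[OF w] x by (simp add: ev_def)
    qed
    with \<psi> show "\<psi> = ?\<psi>"
      by (intro extensionalityI[of _ "carrier (free_product I G)"]) (auto simp: free_product_def)
  qed
qed

end


section \<open>Groups of finite C-width\<close>

definition generating_set :: "('a, 'b) monoid_scheme \<Rightarrow> 'a set \<Rightarrow> bool" where
  "generating_set G S \<longleftrightarrow> S \<subseteq> carrier G \<and> generate G S = carrier G"

text \<open>
  The least number is only meaningful if some factorisation of \<open>g\<close> exists, as is the case for every
  \<open>g\<close> in the carrier if \<open>S\<close> generates \<open>G\<close>; the length is used for such \<open>g\<close> and \<open>S\<close> only.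
\<close>

definition word_length :: "('a, 'b) monoid_scheme \<Rightarrow> 'a set \<Rightarrow> 'a \<Rightarrow> nat" where
  "word_length G S g =
     (LEAST n. \<exists>xs. length xs = n \<and> set xs \<subseteq> S \<union> set_inv\<^bsub>G\<^esub> S \<and> foldr (\<otimes>\<^bsub>G\<^esub>) xs \<one>\<^bsub>G\<^esub> = g)"

definition wid :: "('a, 'b) monoid_scheme \<Rightarrow> 'a set \<Rightarrow> enat" where
  "wid G S = (SUP g\<in>carrier G. enat (word_length G S g))"

definition conjugation_invariant :: "('a, 'b) monoid_scheme \<Rightarrow> 'a set \<Rightarrow> bool" where
  "conjugation_invariant G S \<longleftrightarrow> (\<forall>g\<in>carrier G. (g <#\<^bsub>G\<^esub> S) #>\<^bsub>G\<^esub> (inv\<^bsub>G\<^esub> g) = S)"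

definition finite_C_width :: "('a, 'b) monoid_scheme \<Rightarrow> bool" where
  "finite_C_width G \<longleftrightarrow>
     (\<forall>S. generating_set G S \<and> conjugation_invariant G S \<longrightarrow> wid G S < \<infinity>)"

end

theory Submission
  imports Defs "HOL-Library.Sublist"
begin

text \<open>
  A function \<open>f\<close> from a group to the integers is a quasimorphism if \<open>f (x \<otimes> y) - f x - f y\<close> is bounded.
  If \<open>f\<close> is odd, the values of \<open>f\<close> on a conjugate \<open>g \<otimes> t \<otimes> inv g\<close> and on \<open>t\<close> differ by a bounded
  amount, whatever \<open>g\<close> is. So if \<open>f\<close> is bounded on a generating set \<open>T\<close>, it is bounded on the
  conjugation-invariant generating set of all conjugates of elements of \<open>T\<close>, hence grows at most
  linearly with the length relative to that set. An odd unbounded quasimorphism that is bounded on a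
  generating set therefore rules out finite C-width
  (\<open>quasimorphism_imp_not_finite_C_width\<close>).

  On a free product, such quasimorphisms come from Brooks' counting construction: the number of
  occurrences of a pattern \<open>p\<close> in the normal form minus that of the inverse pattern. A product of two
  normal forms arises by cancelling a segment of one against its inverse in the other and then merging
  at most two letters into one (\<open>product_decomposition\<close>). The cancelled segments have opposite
  counts, and every remaining cut changes the counts by a bounded amount, so this is a quasimorphism.
  It takes only the values -1, 0 and 1 on the factors. It is unbounded if all powers of some cyclically
  reduced word avoid the inverse of \<open>p\<close> although the word itself begins with \<open>p\<close>
  (\<open>not_finite_C_width_if_chiral_pattern\<close>). Such a word exists in each of three cases:
  \<open>(ba)\<^sup>n\<close> with \<open>p = b\<close>, if some \<open>b\<close> is not its own inverse and \<open>a\<close> lies in another factor;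
  \<open>(xyz)\<^sup>n\<close> with \<open>p = xy\<close>, if \<open>x\<close>, \<open>y\<close>, \<open>z\<close> come from three different factors;
  \<open>(bacada)\<^sup>n\<close> with \<open>p = bac\<close>, if \<open>b\<close>, \<open>c\<close>, \<open>d\<close> are distinct nonidentity elements of one factor,
  \<open>b\<close> and \<open>c\<close> are involutions, and \<open>a\<close> lies in another factor. If the first two cases do not
  occur, there are two factors and all their elements are their own inverses. A factor of order other
  than two then contains distinct involutions \<open>b\<close>, \<open>c\<close> and \<open>d = bc\<close>, which is the third case.

  The free product of two groups of order two is the infinite dihedral group. The parities of the number
  of letters from chosen factors are homomorphisms to the group of order two, and every element of odd
  length is a conjugate of a letter. A conjugation-invariant generating set \<open>S\<close> contains an element
  of odd length, hence all conjugates of one of the two letters, say \<open>x\<close>. Each element with an even number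
  of the other letter is a conjugate of \<open>x\<close> or a product of two of them. This subgroup has index two, and
  \<open>S\<close> contains an element outside of it, so every element has length at most 3.
\<close>

section \<open>Width and quasimorphisms\<close>

lemma (in group) foldr_mult_closed:
  "set xs \<subseteq> carrier G \<Longrightarrow> foldr (\<otimes>) xs \<one> \<in> carrier G"
  by (induction xs) auto

lemma (in group) foldr_mult_append:
  "set xs \<subseteq> carrier G \<Longrightarrow> set ys \<subseteq> carrier G \<Longrightarrow>
    foldr (\<otimes>) (xs @ ys) \<one> = foldr (\<otimes>) xs \<one> \<otimes> foldr (\<otimes>) ys \<one>"
  by (induction xs) (auto simp: foldr_mult_closed m_assoc simp del: foldr_append)

lemma (in group) set_inv_subset_carrier:
  "S \<subseteq> carrier G \<Longrightarrow> set_inv S \<subseteq> carrier G"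
  by (auto simp: SET_INV_def)

lemma (in group) generate_factorization:
  assumes S: "S \<subseteq> carrier G" and g: "g \<in> generate G S"
  shows "\<exists>xs. set xs \<subseteq> S \<union> set_inv S \<and> foldr (\<otimes>) xs \<one> = g"
  using g
proof induction
  case one
  show ?case by (rule exI[of _ "[]"]) simp
next
  case (incl h)
  then show ?case using S by (intro exI[of _ "[h]"]) auto
next
  case (inv h)
  then show ?case using S by (intro exI[of _ "[inv h]"]) (auto simp: SET_INV_def)
next
  case (eng h k)
  then obtain xs ys where xs: "set xs \<subseteq> S \<union> set_inv S" "foldr (\<otimes>) xs \<one> = h"
    and ys: "set ys \<subseteq> S \<union> set_inv S" "foldr (\<otimes>) ys \<one> = k" by blast
  moreover have "S \<union> set_inv S \<subseteq> carrier G" using S set_inv_subset_carrier by blast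
  ultimately have "foldr (\<otimes>) (xs @ ys) \<one> = h \<otimes> k"
    using foldr_mult_append[of xs ys] by blast
  then show ?case using xs(1) ys(1) by (intro exI[of _ "xs @ ys"]) auto
qed

text \<open>
  A uniform bound on the number of generators takes the place of the supremum of least lengths. The
  width is bounded above, and shown to be infinite, in this form.
\<close>

lemma (in group) wid_finite_iff:
  assumes S: "generating_set G S"
  shows "wid G S < \<infinity> \<longleftrightarrow>
    (\<exists>N. \<forall>g\<in>carrier G. \<exists>xs. length xs \<le> N \<and> set xs \<subseteq> S \<union> set_inv S \<and> foldr (\<otimes>) xs \<one> = g)"
    (is "_ \<longleftrightarrow> (\<exists>N. \<forall>g\<in>carrier G. ?bounded N g)")
proof
  assume "wid G S < \<infinity>"
  then obtain N where N: "wid G S = enat N" by auto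
  have "?bounded N g" if g: "g \<in> carrier G" for g
  proof -
    have "enat (word_length G S g) \<le> wid G S" unfolding wid_def by (rule SUP_upper[OF g])
    then have le: "word_length G S g \<le> N" by (simp add: N)
    have "\<exists>n xs. length xs = n \<and> set xs \<subseteq> S \<union> set_inv S \<and> foldr (\<otimes>) xs \<one> = g"
      using generate_factorization[of S g] S g by (auto simp: generating_set_def)
    from LeastI_ex[OF this] le show ?thesis
      unfolding word_length_def[symmetric] by (elim exE conjE) (intro exI conjI, auto)
  qed
  then show "\<exists>N. \<forall>g\<in>carrier G. ?bounded N g" by blast
next
  assume "\<exists>N. \<forall>g\<in>carrier G. ?bounded N g"
  then obtain N where N: "\<And>g. g \<in> carrier G \<Longrightarrow> ?bounded N g" by blast
  have "word_length G S g \<le> N" if "g \<in> carrier G" for g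
  proof -
    obtain xs where xs: "length xs \<le> N" "set xs \<subseteq> S \<union> set_inv S" "foldr (\<otimes>) xs \<one> = g"
      using N[OF \<open>g \<in> carrier G\<close>] by blast
    have "word_length G S g \<le> length xs"
      unfolding word_length_def using xs(2,3) by (intro Least_le) auto
    with xs(1) show ?thesis by simp
  qed
  then have "wid G S \<le> enat N" unfolding wid_def by (intro SUP_least) simp
  then show "wid G S < \<infinity>" using enat_ord_simps(4) le_less_trans by blast
qed

lemma (in group) conjugation_invariant_iff:
  assumes S: "S \<subseteq> carrier G"
  shows "conjugation_invariant G S \<longleftrightarrow> (\<forall>g\<in>carrier G. \<forall>s\<in>S. g \<otimes> s \<otimes> inv g \<in> S)"
proof -
  have conj: "(g <# S) #> inv g = (\<lambda>s. g \<otimes> s \<otimes> inv g) ` S" for g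
    by (auto simp: l_coset_def r_coset_def)
  show ?thesis
  proof
    assume "conjugation_invariant G S"
    then show "\<forall>g\<in>carrier G. \<forall>s\<in>S. g \<otimes> s \<otimes> inv g \<in> S"
      unfolding conjugation_invariant_def conj by blast
  next
    assume *: "\<forall>g\<in>carrier G. \<forall>s\<in>S. g \<otimes> s \<otimes> inv g \<in> S"
    show "conjugation_invariant G S"
      unfolding conjugation_invariant_def conj
    proof (intro ballI equalityI subsetI)
      fix g s assume g: "g \<in> carrier G" and s: "s \<in> S"
      \<comment> \<open>The inclusion of \<open>S\<close> in its conjugate by \<open>g\<close> is invariance under the inverse of \<open>g\<close>.\<close>
      have "s = g \<otimes> (inv g \<otimes> s \<otimes> inv (inv g)) \<otimes> inv g"
        using g s S by (simp add: m_assoc[symmetric] subsetD[OF S]) (simp add: m_assoc subsetD[OF S])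
      moreover have "inv g \<otimes> s \<otimes> inv (inv g) \<in> S" using * g s by blast
      ultimately show "s \<in> (\<lambda>s. g \<otimes> s \<otimes> inv g) ` S" by blast
    qed (use * in auto)
  qed
qed

text \<open>
  With \<open>f\<close> odd, \<open>f (g \<otimes> t \<otimes> inv g)\<close> differs from \<open>f g + f t - f g = f t\<close> by at most \<open>2 * C\<close>, so
  \<open>f\<close> remains bounded on the closure of \<open>T\<close> under conjugation. Finite width relative to this closure
  would bound \<open>f\<close> on the whole group.
\<close>

theorem (in group) quasimorphism_imp_not_finite_C_width:
  fixes f :: "'a \<Rightarrow> int"
  assumes qm: "\<And>x y. x \<in> carrier G \<Longrightarrow> y \<in> carrier G \<Longrightarrow> \<bar>f (x \<otimes> y) - f x - f y\<bar> \<le> C"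
    and odd: "\<And>x. x \<in> carrier G \<Longrightarrow> f (inv x) = - f x"
    and T: "generating_set G T"
    and bounded: "\<And>t. t \<in> T \<Longrightarrow> \<bar>f t\<bar> \<le> B"
    and unbounded: "\<And>N. \<exists>x\<in>carrier G. f x > N"
  shows "\<not> finite_C_width G"
proof
  assume fin: "finite_C_width G"
  have T_sub: "T \<subseteq> carrier G" using T by (simp add: generating_set_def)
  define S where "S = {g \<otimes> t \<otimes> inv g | g t. g \<in> carrier G \<and> t \<in> T}"
  have S_sub: "S \<subseteq> carrier G" using T_sub by (auto simp: S_def)
  have "T \<subseteq> S"
  proof
    fix t assume "t \<in> T"
    then have "t = \<one> \<otimes> t \<otimes> inv \<one>" using T_sub by auto
    with \<open>t \<in> T\<close> show "t \<in> S" unfolding S_def by blast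
  qed
  then have "carrier G \<subseteq> generate G S" using T mono_generate[of T S] by (auto simp: generating_set_def)
  then have gen: "generating_set G S" 
    using S_sub generate_incl[OF S_sub] by (auto simp: generating_set_def)
  have "h \<otimes> s \<otimes> inv h \<in> S" if h: "h \<in> carrier G" and s: "s \<in> S" for h s
  proof -
    obtain g t where g: "g \<in> carrier G" "t \<in> T" "s = g \<otimes> t \<otimes> inv g" using s by (auto simp: S_def)
    moreover from g have "t \<in> carrier G" using T_sub by blast
    ultimately have "h \<otimes> s \<otimes> inv h = (h \<otimes> g) \<otimes> t \<otimes> inv (h \<otimes> g)"
      using h by (simp add: inv_mult_group m_assoc)
    then show ?thesis using g h unfolding S_def by blast
  qed
  then have "conjugation_invariant G S" using conjugation_invariant_iff[OF S_sub] by blast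
  with fin gen have "wid G S < \<infinity>" by (auto simp: finite_C_width_def)
  then obtain N where N: "\<And>g. g \<in> carrier G \<Longrightarrow>
      \<exists>xs. length xs \<le> N \<and> set xs \<subseteq> S \<union> set_inv S \<and> foldr (\<otimes>) xs \<one> = g"
    using wid_finite_iff[OF gen] by auto
  have S_bound: "\<bar>f s\<bar> \<le> B + 2 * C" if "s \<in> S" for s
  proof -
    obtain g t where g: "g \<in> carrier G" "t \<in> T" "s = g \<otimes> t \<otimes> inv g"
      using \<open>s \<in> S\<close> by (auto simp: S_def)
    moreover from g have "t \<in> carrier G" using T_sub by blast
    ultimately show ?thesis
      using qm[of "g \<otimes> t" "inv g"] qm[of g t] odd[of g] bounded[of t] by simp
  qed
  have SS_bound: "\<bar>f s\<bar> \<le> B + 2 * C" if "s \<in> S \<union> set_inv S" for s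
    using that S_bound odd S_sub by (auto simp: SET_INV_def subset_iff)
  have SS_sub: "S \<union> set_inv S \<subseteq> carrier G" using S_sub set_inv_subset_carrier by blast
  have f_one: "f \<one> = 0" using odd[of \<one>] by simp
  have product_bound: "\<bar>f (foldr (\<otimes>) xs \<one>)\<bar> \<le> int (length xs) * (B + 3 * C)"
    if "set xs \<subseteq> S \<union> set_inv S" for xs
    using that
  proof (induction xs)
    case (Cons x xs)
    have x: "x \<in> carrier G" "foldr (\<otimes>) xs \<one> \<in> carrier G"
      using Cons.prems SS_sub by (auto intro!: foldr_mult_closed)
    show ?case
      using Cons qm[OF x] SS_bound[of x] by (simp add: algebra_simps)
  qed (simp add: f_one)
  obtain x where x: "x \<in> carrier G" "f x > int N * \<bar>B + 3 * C\<bar>" using unbounded by blast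
  obtain xs where xs: "length xs \<le> N" "set xs \<subseteq> S \<union> set_inv S" "foldr (\<otimes>) xs \<one> = x"
    using N[OF x(1)] by blast
  have "f x \<le> int (length xs) * \<bar>B + 3 * C\<bar>"
    using product_bound[OF xs(2)] xs(3) 
    by (smt (verit, best) mult_left_mono of_nat_0_le_iff)
  also have "\<dots> \<le> int N * \<bar>B + 3 * C\<bar>" using xs(1) by (intro mult_right_mono) auto
  finally show False using x(2) by simp
qed

section \<open>Occurrences of a pattern in a word\<close>

primrec occurrences :: "'a list \<Rightarrow> 'a list \<Rightarrow> nat" where
  "occurrences p [] = 0"
| "occurrences p (x # w) = of_bool (prefix p (x # w)) + occurrences p w"

lemma occurrences_append_ge: "occurrences p u + occurrences p v \<le> occurrences p (u @ v)"
proof (induction u)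
  case (Cons x u)
  have "prefix p (x # u @ v)" if "prefix p (x # u)"
    using that prefix_prefix[of p "x # u" v] by simp
  with Cons show ?case by auto
qed simp

text \<open>
  Only occurrences that cross the cut between \<open>u\<close> and \<open>v\<close> are not counted on the right, and each of
  them starts among the last letters of \<open>u\<close>, fewer than \<open>length p\<close>. The induction on \<open>u\<close> needs the
  minimum in the bound: a short \<open>u\<close> offers at most \<open>length u\<close> starting positions.
\<close>

lemma occurrences_append_le:
  "occurrences p (u @ v) \<le> occurrences p u + occurrences p v + length p"
proof -
  have "occurrences p (u @ v) \<le> occurrences p u + occurrences p v + min (length u) (length p)"
  proof (induction u)
    case (Cons x u)
    have "prefix p (x # u)" if "prefix p (x # u @ v)" "length p \<le> Suc (length u)"
      using that prefix_length_prefix[of p "x # u @ v" "x # u"] by simp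
    then show ?case using Cons by (auto simp: min_def split: if_splits)
  qed simp
  then show ?thesis by simp
qed

text \<open>
  Counts occurrences by their last letter instead of their first one. This makes the effect of
  reversal on \<^const>\<open>occurrences\<close> accessible to induction.
\<close>

lemma occurrences_snoc:
  "p \<noteq> [] \<Longrightarrow> occurrences p (w @ [x]) = occurrences p w + of_bool (suffix p (w @ [x]))"
proof (induction w)
  case Nil
  then show ?case by (auto simp: prefix_Cons suffix_Cons)
next
  case (Cons y w)
  have "\<not> prefix p (y # w)" if "p = y # w @ [x]"
    using prefix_length_le[of p "y # w"] that by auto
  moreover have "\<not> suffix p (w @ [x])" if "p = y # w @ [x]"
    using suffix_length_le[of p "w @ [x]"] that by auto
  ultimately show ?case
    using Cons prefix_snoc[of p "y # w" x] by (auto simp: suffix_Cons simp del: prefix_snoc)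
qed

section \<open>Inverses and products of reduced words\<close>

definition inverse_word :: "('i \<Rightarrow> ('a, 'b) monoid_scheme) \<Rightarrow> ('i \<times> 'a) list \<Rightarrow> ('i \<times> 'a) list" where
  "inverse_word G w = rev (map (\<lambda>(i, g). (i, inv\<^bsub>G i\<^esub> g)) w)"

definition letters :: "'i set \<Rightarrow> ('i \<Rightarrow> ('a, 'b) monoid_scheme) \<Rightarrow> ('i \<times> 'a) list set" where
  "letters I G = (\<lambda>x. [x]) ` (SIGMA i:I. carrier (G i) - {\<one>\<^bsub>G i\<^esub>})"

text \<open>
  Brooks' counting function. Subtracting the count of the inverse pattern makes it odd under inversion.
\<close>

definition brooks ::
    "('i \<Rightarrow> ('a, 'b) monoid_scheme) \<Rightarrow> ('i \<times> 'a) list \<Rightarrow> ('i \<times> 'a) list \<Rightarrow> int" where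
  "brooks G p w = int (occurrences p w) - int (occurrences (inverse_word G p) w)"

definition count_in :: "'i set \<Rightarrow> ('i \<times> 'a) list \<Rightarrow> nat" where
  "count_in J w = length (filter (\<lambda>x. fst x \<in> J) w)"

lemma inverse_word_simps [simp]:
  "inverse_word G [] = []"
  "inverse_word G ((i, g) # w) = inverse_word G w @ [(i, inv\<^bsub>G i\<^esub> g)]"
  "inverse_word G (u @ v) = inverse_word G v @ inverse_word G u"
  "length (inverse_word G w) = length w"
  "inverse_word G w = [] \<longleftrightarrow> w = []"
  by (auto simp: inverse_word_def)

context
  fixes I :: "'i set" and G :: "'i \<Rightarrow> ('a, 'b) monoid_scheme"
  assumes groups: "\<And>i. i \<in> I \<Longrightarrow> group (G i)"
begin

abbreviation (input) "FP \<equiv> free_product I G"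

interpretation FP: group FP by (rule group_free_product[OF groups])

lemma free_product_simps:
  "carrier FP = reduced_words I G"
  "\<one>\<^bsub>FP\<^esub> = []"
  "u \<otimes>\<^bsub>FP\<^esub> v = foldr (letter_mult G) u v"
  by (simp_all add: free_product_def)

lemma reduced_words_append:
  "u @ v \<in> reduced_words I G \<longleftrightarrow> u \<in> reduced_words I G \<and> v \<in> reduced_words I G \<and>
     (u = [] \<or> v = [] \<or> fst (last u) \<noteq> fst (hd v))"
  by (auto simp: reduced_words_def successively_append_iff)

lemma reduced_words_letters:
  "w \<in> reduced_words I G \<Longrightarrow> set w \<subseteq> (SIGMA i:I. carrier (G i))"
  by (auto simp: reduced_words_def)

lemma inverse_word_involution:
  assumes "set w \<subseteq> (SIGMA i:I. carrier (G i))"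
  shows "inverse_word G (inverse_word G w) = w"
  using assms groups by (induction w) (auto simp: group.inv_inv)

lemma inverse_word_closed:
  assumes "w \<in> reduced_words I G"
  shows "inverse_word G w \<in> reduced_words I G"
  using assms
proof (induction w)
  case (Cons x w)
  obtain i g where x: "x = (i, g)" by (cases x)
  have ig: "i \<in> I" "g \<in> carrier (G i)" "g \<noteq> \<one>\<^bsub>G i\<^esub>" "w \<in> reduced_words I G" "w = [] \<or> fst (hd w) \<noteq> i"
    using Cons.prems x by (auto simp: reduced_words_Cons[OF groups])
  interpret group "G i" by (rule groups[OF ig(1)])
  have "fst (last (inverse_word G w)) = fst (hd w)" if "w \<noteq> []"
    using that by (auto simp: inverse_word_def last_rev hd_map split: prod.split)
  moreover have "[(i, inv\<^bsub>G i\<^esub> g)] \<in> reduced_words I G"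
    using ig by (auto simp: reduced_words_Cons[OF groups] reduced_words_Nil[OF groups] inv_eq_1_iff)
  ultimately show ?case
    using Cons.IH ig x by (auto simp: reduced_words_append)
qed (simp add: reduced_words_Nil[OF groups])

lemma letter_mult_inv_cancel:
  assumes "i \<in> I" "g \<in> carrier (G i)" "g \<noteq> \<one>\<^bsub>G i\<^esub>"
  shows "letter_mult G (i, g) ((i, inv\<^bsub>G i\<^esub> g) # v) = v"
proof -
  interpret group "G i" by (rule groups[OF assms(1)])
  show ?thesis using assms by simp
qed

lemma mult_inverse_word_append:
  assumes "w \<in> reduced_words I G"
  shows "foldr (letter_mult G) w (inverse_word G w @ v) = v"
  using assms
proof (induction w arbitrary: v)
  case (Cons x w)
  then show ?case
    by (cases x) (auto simp: reduced_words_Cons[OF groups] letter_mult_inv_cancel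
        simp del: letter_mult.simps)
qed simp

lemma inv_free_product:
  assumes "w \<in> reduced_words I G"
  shows "inv\<^bsub>FP\<^esub> w = inverse_word G w"
proof (rule FP.inv_equality[OF _ ])
  have w: "w \<in> carrier FP" "inverse_word G w \<in> carrier FP"
    using assms inverse_word_closed by (simp_all add: free_product_simps)
  have "w \<otimes>\<^bsub>FP\<^esub> inverse_word G w = \<one>\<^bsub>FP\<^esub>"
    using mult_inverse_word_append[OF assms, of "[]"] by (simp add: free_product_simps)
  then show "inverse_word G w \<otimes>\<^bsub>FP\<^esub> w = \<one>\<^bsub>FP\<^esub>" using w FP.inv_comm by blast
qed (use assms inverse_word_closed in \<open>auto simp: free_product_simps\<close>)

lemma mult_reduced_append:
  assumes "u @ v \<in> reduced_words I G"
  shows "u \<otimes>\<^bsub>FP\<^esub> v = u @ v"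
proof -
  have uv: "u \<in> reduced_words I G" "v \<in> reduced_words I G" using assms by (auto simp: reduced_words_append)
  have "foldr (letter_mult G) (u @ v) [] = foldr (letter_mult G) u (foldr (letter_mult G) v [])" by simp
  then show ?thesis
    using foldr_letter_mult_Nil[OF groups assms] foldr_letter_mult_Nil[OF groups uv(2)]
    by (simp add: free_product_simps)
qed

text \<open>
  The segment \<open>t\<close> of \<open>u\<close> cancels against its inverse in \<open>v\<close>; \<open>x\<close> and
  \<open>y\<close> are the two letters that merge into \<open>z\<close>, and all three are empty if no letters merge.

  The induction on \<open>u\<close> distinguishes two states. While \<open>cancelled\<close> holds, \<open>u\<close> has been used up
  completely, and the next letter may cancel, merge or be kept. In the state \<open>merged\<close> the product
  starts with a letter of the same factor as \<open>u\<close> does, so the next letter cannot interact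
  with it and only lengthens the uncancelled part.
\<close>

lemma product_decomposition:
  assumes "u \<in> reduced_words I G" "v \<in> reduced_words I G"
  obtains u' x t y z v' where
    "u = u' @ x @ t" "v = inverse_word G t @ y @ v'" "u \<otimes>\<^bsub>FP\<^esub> v = u' @ z @ v'"
    "length x \<le> 1" "length y \<le> 1" "length z \<le> 1"
proof -
  let ?uv = "\<lambda>u. foldr (letter_mult G) u v"
  define cancelled where "cancelled u \<longleftrightarrow> v = inverse_word G u @ ?uv u" for u
  define merged where "merged u \<longleftrightarrow> (\<exists>u' x t y z v'. u = u' @ x @ t \<and> v = inverse_word G t @ y @ v' \<and>
      ?uv u = u' @ z @ v' \<and> length x \<le> 1 \<and> length y \<le> 1 \<and> length z \<le> 1 \<and>
      u \<noteq> [] \<and> ?uv u \<noteq> [] \<and> fst (hd (?uv u)) = fst (hd u))" for u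
  have "cancelled u \<or> merged u"
    using assms(1)
  proof (induction u)
    case Nil
    then show ?case by (simp add: cancelled_def)
  next
    case (Cons a u)
    obtain i g where a: "a = (i, g)" by (cases a)
    have ig: "i \<in> I" "g \<in> carrier (G i)" "g \<noteq> \<one>\<^bsub>G i\<^esub>" "u \<in> reduced_words I G" "u = [] \<or> fst (hd u) \<noteq> i"
      using Cons.prems a by (auto simp: reduced_words_Cons[OF groups])
    interpret group "G i" by (rule groups[OF ig(1)])
    consider (can) "cancelled u" | (mer) "merged u" using Cons.IH[OF ig(4)] by blast
    then show ?case
    proof cases
      case mer
      then have "?uv (a # u) = a # ?uv u"
        using ig a unfolding merged_def by (cases "?uv u") auto
      moreover obtain u' x t y z v' where
        "u = u' @ x @ t" "v = inverse_word G t @ y @ v'" "?uv u = u' @ z @ v'"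
        "length x \<le> 1" "length y \<le> 1" "length z \<le> 1"
        using mer unfolding merged_def by blast
      ultimately have "merged (a # u)"
        unfolding merged_def
        by (intro exI[of _ "a # u'"] exI[of _ x] exI[of _ t] exI[of _ y] exI[of _ z] exI[of _ v'])
          (simp del: foldr.simps foldr_append)
      then show ?thesis ..
    next
      case can
      define r where "r = ?uv u"
      have uv: "?uv (a # u) = letter_mult G (i, g) r" by (simp add: r_def a)
      have v: "v = inverse_word G u @ r" using can unfolding cancelled_def r_def .
      have red: "r \<in> reduced_words I G"
        unfolding r_def by (rule foldr_letter_mult_closed[OF groups ig(4) assms(2)])
      show ?thesis
      proof (cases "\<exists>h w. r = (i, h) # w")
        case False
        then have "?uv (a # u) = a # r"
          unfolding uv using ig(3) a by (cases r) auto
        with v have "merged (a # u)"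
          unfolding merged_def
          by (intro exI[of _ "[a]"] exI[of _ "[]"] exI[of _ u] exI[of _ r])
            (simp del: foldr.simps)
        then show ?thesis ..
      next
        case True
        then obtain h w where w: "r = (i, h) # w" by blast
        have h: "h \<in> carrier (G i)" using red w by (auto simp: reduced_words_Cons[OF groups])
        show ?thesis
        proof (cases "g \<otimes>\<^bsub>G i\<^esub> h = \<one>\<^bsub>G i\<^esub>")
          case True
          then have "h = inv\<^bsub>G i\<^esub> g" using ig(2) h inv_equality inv_comm by metis
          moreover have "?uv (a # u) = w" unfolding uv using w True ig(3) by simp
          ultimately have "cancelled (a # u)"
            using v w a unfolding cancelled_def by (simp del: foldr.simps)
          then show ?thesis ..
        next
          case False
          then have "?uv (a # u) = (i, g \<otimes>\<^bsub>G i\<^esub> h) # w"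
            unfolding uv using ig(3) w by simp
          with v w a have "merged (a # u)"
            unfolding merged_def
            by (intro exI[of _ "[]"] exI[of _ "[a]"] exI[of _ u] exI[of _ "[(i, h)]"]
                exI[of _ "[(i, g \<otimes>\<^bsub>G i\<^esub> h)]"] exI[of _ w]) (simp del: foldr.simps)
          then show ?thesis ..
        qed
      qed
    qed
  qed
  then show thesis
  proof
    assume "cancelled u"
    then show thesis
      unfolding cancelled_def by (intro that[of "[]" "[]" u "[]" "?uv u" "[]"]) (simp_all add: free_product_simps)
  next
    assume "merged u"
    then show thesis
      unfolding merged_def free_product_simps(3)[symmetric] using that by blast
  qed
qed

section \<open>Brooks quasimorphisms on free products\<close>

text \<open>
  By the decomposition above, \<open>f u\<close>, \<open>f v\<close> and \<open>f (u \<otimes> v)\<close> are, up to \<open>2 * D + B\<close> each, equal to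
  \<open>f u' + f t\<close>, \<open>- f t + f v'\<close> and \<open>f u' + f v'\<close>.
\<close>

lemma quasi_additive_imp_quasimorphism:
  fixes f :: "('i \<times> 'a) list \<Rightarrow> int"
  assumes add: "\<And>u v. \<bar>f (u @ v) - f u - f v\<bar> \<le> D"
    and odd: "\<And>w. w \<in> reduced_words I G \<Longrightarrow> f (inverse_word G w) = - f w"
    and short: "\<And>w. length w \<le> 1 \<Longrightarrow> \<bar>f w\<bar> \<le> B"
    and u: "u \<in> reduced_words I G" and v: "v \<in> reduced_words I G"
  shows "\<bar>f (u \<otimes>\<^bsub>FP\<^esub> v) - f u - f v\<bar> \<le> 6 * D + 3 * B"
proof -
  obtain u' x t y z v' where
    eq: "u = u' @ x @ t" "v = inverse_word G t @ y @ v'" "u \<otimes>\<^bsub>FP\<^esub> v = u' @ z @ v'"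
    and le: "length x \<le> 1" "length y \<le> 1" "length z \<le> 1"
    by (rule product_decomposition[OF u v])
  have split: "\<bar>f (a @ m @ b) - f a - f b\<bar> \<le> 2 * D + B" if "length m \<le> 1" for a m b
    using add[of a "m @ b"] add[of m b] short[OF that] by linarith
  have "f (inverse_word G t) = - f t" using odd u eq(1) by (auto simp: reduced_words_append)
  then show ?thesis
    using split[OF le(1), of u' t] split[OF le(2), of "inverse_word G t" v'] split[OF le(3), of u' v']
    unfolding eq(3) unfolding eq(1,2) by linarith
qed

lemma occurrences_inverse_word:
  assumes p: "set p \<subseteq> (SIGMA i:I. carrier (G i))" "p \<noteq> []"
    and w: "set w \<subseteq> (SIGMA i:I. carrier (G i))"
  shows "occurrences (inverse_word G p) (inverse_word G w) = occurrences p w"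
  using w
proof (induction w)
  case (Cons x w)
  obtain i g where x: "x = (i, g)" by (cases x)
  have "suffix (inverse_word G p) (inverse_word G (x # w)) \<longleftrightarrow> prefix p (x # w)"
  proof
    assume "suffix (inverse_word G p) (inverse_word G (x # w))"
    then obtain u where u: "inverse_word G (x # w) = u @ inverse_word G p" by (auto simp: suffix_def)
    then have "inverse_word G (inverse_word G (x # w)) = inverse_word G (inverse_word G p) @ inverse_word G u"
      by (metis inverse_word_simps(3))
    then have "x # w = p @ inverse_word G u" 
      using inverse_word_involution[OF Cons.prems] inverse_word_involution[OF p(1)] by simp
    then show "prefix p (x # w)" by auto
  next
    assume "prefix p (x # w)"
    then obtain u where "x # w = p @ u" by (auto simp: prefix_def)
    then show "suffix (inverse_word G p) (inverse_word G (x # w))" by (auto simp: suffix_def)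
  qed
  then show ?case using Cons p(2) x by (simp add: occurrences_snoc)
qed (use p in simp)

lemma brooks_append: "\<bar>brooks G p (u @ v) - brooks G p u - brooks G p v\<bar> \<le> int (length p)"
  using occurrences_append_ge[of p u v] occurrences_append_le[of p u v]
    occurrences_append_ge[of "inverse_word G p" u v] occurrences_append_le[of "inverse_word G p" u v]
  by (simp add: brooks_def)

lemma brooks_inverse_word:
  assumes p: "p \<in> reduced_words I G" "p \<noteq> []" and w: "w \<in> reduced_words I G"
  shows "brooks G p (inverse_word G w) = - brooks G p w"
proof -
  have "occurrences (inverse_word G p) (inverse_word G w) = occurrences p w"
    using occurrences_inverse_word[of p w] p w reduced_words_letters by blast
  moreover have "occurrences (inverse_word G (inverse_word G p)) (inverse_word G w) =
      occurrences (inverse_word G p) w"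
    using occurrences_inverse_word[of "inverse_word G p" w] p w reduced_words_letters inverse_word_closed
    by (metis inverse_word_simps(5))
  moreover have "inverse_word G (inverse_word G p) = p"
    using inverse_word_involution p(1) reduced_words_letters by blast
  ultimately show ?thesis by (simp add: brooks_def)
qed

lemma brooks_short: "length w \<le> 1 \<Longrightarrow> \<bar>brooks G p w\<bar> \<le> 1"
  by (cases w) (auto simp: brooks_def)

lemma generating_set_letters: "generating_set FP (letters I G)"
proof -
  have sub: "letters I G \<subseteq> carrier FP"
    by (auto simp: letters_def free_product_simps reduced_words_Cons[OF groups] reduced_words_Nil[OF groups])
  have "w \<in> generate FP (letters I G)" if "w \<in> reduced_words I G" for w
    using that
  proof (induction w)
    case Nil
    then show ?case using generate.one[of FP "letters I G"] by (simp add: free_product_simps)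
  next
    case (Cons x w)
    obtain i g where x: "x = (i, g)" by (cases x)
    have w: "w \<in> reduced_words I G" and "[x] \<in> letters I G"
      using Cons.prems x by (auto simp: reduced_words_Cons[OF groups] letters_def)
    then have "[x] \<otimes>\<^bsub>FP\<^esub> w \<in> generate FP (letters I G)"
      using Cons.IH by (intro generate.eng) (auto intro: generate.incl)
    then show ?case using mult_reduced_append[of "[x]" w] Cons.prems by simp
  qed
  then show ?thesis
    using sub FP.generate_incl[OF sub] by (auto simp: generating_set_def free_product_simps)
qed

lemma power_word_reduced:
  assumes "v \<in> reduced_words I G" "v \<noteq> []" "fst (last v) \<noteq> fst (hd v)"
  shows "concat (replicate n v) \<in> reduced_words I G"
proof (induction n)
  case (Suc n)
  then show ?case using assms by (cases n) (auto simp: reduced_words_append)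
qed (simp add: reduced_words_Nil[OF groups])

text \<open>
  The Brooks function of \<open>p\<close> is at least \<open>n\<close> on the \<open>n\<close>-th power of \<open>v\<close>: each copy of \<open>v\<close>
  starts with \<open>p\<close>, and no occurrence of the inverse pattern starts inside a copy of \<open>v\<close>.
  The latter is assumed for arbitrary continuations \<open>w\<close>, which for explicit words can be read off
  from \<open>v\<close> alone.
\<close>

lemma not_finite_C_width_if_chiral_pattern:
  assumes v: "v \<in> reduced_words I G" "fst (last v) \<noteq> fst (hd v)"
    and p: "p \<noteq> []" "prefix p v"
    and absent: "\<And>w. occurrences (inverse_word G p) (v @ w) = occurrences (inverse_word G p) w"
  shows "\<not> finite_C_width FP"
proof (rule FP.quasimorphism_imp_not_finite_C_width[OF _ _ generating_set_letters])
  have v_ne: "v \<noteq> []" using p by auto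
  have p_red: "p \<in> reduced_words I G" using p v by (auto simp: prefix_def reduced_words_append)
  show "\<bar>brooks G p (x \<otimes>\<^bsub>FP\<^esub> y) - brooks G p x - brooks G p y\<bar> \<le> 6 * int (length p) + 3 * 1"
    if "x \<in> carrier FP" "y \<in> carrier FP" for x y
    using that brooks_append brooks_inverse_word[OF p_red p(1)] brooks_short
    by (intro quasi_additive_imp_quasimorphism) (auto simp: free_product_simps)
  show "brooks G p (inv\<^bsub>FP\<^esub> x) = - brooks G p x" if "x \<in> carrier FP" for x
    using that brooks_inverse_word[OF p_red p(1)] by (simp add: inv_free_product free_product_simps)
  show "\<bar>brooks G p t\<bar> \<le> 1" if "t \<in> letters I G" for t
    using that by (intro brooks_short) (auto simp: letters_def)
  show "\<exists>x\<in>carrier FP. N < brooks G p x" for N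
  proof -
    define w where "w n = concat (replicate n v)" for n
    have "occurrences p (w n) \<ge> n" for n
    proof (induction n)
      case (Suc n)
      have "1 \<le> occurrences p v" using v_ne p by (cases v) auto
      then show ?case using Suc occurrences_append_ge[of p v "w n"] by (simp add: w_def)
    qed simp
    moreover have "occurrences (inverse_word G p) (w n) = 0" for n
      using absent by (induction n) (auto simp: w_def)
    ultimately have "brooks G p (w n) \<ge> int n" for n by (simp add: brooks_def)
    moreover have "N < int (nat (N + 1))" by simp
    ultimately have "N < brooks G p (w (nat (N + 1)))" by (meson less_le_trans)
    then show ?thesis
      using power_word_reduced[OF v(1) v_ne v(2)] by (auto simp: w_def free_product_simps)
  qed
qed


section \<open>Chiral patterns in free products other than the infinite dihedral group\<close>

lemma nonidentity_element:
  assumes "i \<in> I" "\<not> trivial_group (G i)"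
  obtains a where "a \<in> carrier (G i)" "a \<noteq> \<one>\<^bsub>G i\<^esub>"
proof -
  interpret group "G i" by (rule groups[OF assms(1)])
  have "carrier (G i) \<noteq> {\<one>\<^bsub>G i\<^esub>}" using assms(2) is_group by (auto simp: trivial_group_def)
  then show thesis using that one_closed by blast
qed

lemma not_finite_C_width_if_noninvolution:
  assumes "i \<in> I" "b \<in> carrier (G i)" "inv\<^bsub>G i\<^esub> b \<noteq> b"
    and "j \<in> I" "j \<noteq> i" "a \<in> carrier (G j)" "a \<noteq> \<one>\<^bsub>G j\<^esub>"
  shows "\<not> finite_C_width FP"
proof -
  interpret group "G i" by (rule groups[OF assms(1)])
  have "b \<noteq> \<one>\<^bsub>G i\<^esub>" using assms(3) by auto
  then show ?thesis
    using assms
    by (intro not_finite_C_width_if_chiral_pattern[of "[(i, b), (j, a)]" "[(i, b)]"])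
      (auto simp: reduced_words_Cons[OF groups] reduced_words_Nil[OF groups])
qed

text \<open>
  In the powers of \<open>xyz\<close> the factors follow each other in cyclic order, whereas an occurrence of the
  inverse of \<open>xy\<close> would need a letter of the first factor right after one of the second.
\<close>

lemma not_finite_C_width_if_three_factors:
  assumes "i \<in> I" "j \<in> I" "k \<in> I" "i \<noteq> j" "i \<noteq> k" "j \<noteq> k"
    and "x \<in> carrier (G i)" "x \<noteq> \<one>\<^bsub>G i\<^esub>" "y \<in> carrier (G j)" "y \<noteq> \<one>\<^bsub>G j\<^esub>"
    and "z \<in> carrier (G k)" "z \<noteq> \<one>\<^bsub>G k\<^esub>"
  shows "\<not> finite_C_width FP"
  using assms
  by (intro not_finite_C_width_if_chiral_pattern[of "[(i, x), (j, y), (k, z)]" "[(i, x), (j, y)]"])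
    (auto simp: reduced_words_Cons[OF groups] reduced_words_Nil[OF groups])

text \<open>
  The letters in factor \<open>i\<close> of the powers of \<open>bacada\<close> run through \<open>b\<close>, \<open>c\<close>, \<open>d\<close> in cyclic order. The
  inverse of \<open>bac\<close> would make \<open>b\<close> follow \<open>c\<close>. A third letter is what gives the cycle an orientation.
\<close>

lemma not_finite_C_width_if_two_involutions_and_third:
  assumes "i \<in> I" "j \<in> I" "j \<noteq> i" "a \<in> carrier (G j)" "a \<noteq> \<one>\<^bsub>G j\<^esub>"
    and "b \<in> carrier (G i)" "b \<noteq> \<one>\<^bsub>G i\<^esub>" "inv\<^bsub>G i\<^esub> b = b"
    and "c \<in> carrier (G i)" "c \<noteq> \<one>\<^bsub>G i\<^esub>" "inv\<^bsub>G i\<^esub> c = c"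
    and "d \<in> carrier (G i)" "d \<noteq> \<one>\<^bsub>G i\<^esub>"
    and "b \<noteq> c" "b \<noteq> d" "c \<noteq> d"
  shows "\<not> finite_C_width FP"
  using assms
  by (intro not_finite_C_width_if_chiral_pattern[of
        "[(i, b), (j, a), (i, c), (j, a), (i, d), (j, a)]" "[(i, b), (j, a), (i, c)]"])
    (auto simp: reduced_words_Cons[OF groups] reduced_words_Nil[OF groups])

lemma finite_C_width_imp_infinite_dihedral:
  assumes nontrivial: "\<And>i. i \<in> I \<Longrightarrow> \<not> trivial_group (G i)"
    and two: "\<exists>i\<in>I. \<exists>j\<in>I. i \<noteq> j"
    and fin: "finite_C_width FP"
  shows "card I = 2 \<and> (\<forall>i\<in>I. order (G i) = 2)"
proof -
  have other: "\<exists>j\<in>I. j \<noteq> i" for i using two by metis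
  have involutions: "inv\<^bsub>G i\<^esub> b = b" if i: "i \<in> I" "b \<in> carrier (G i)" for i b
  proof (rule ccontr)
    assume b: "inv\<^bsub>G i\<^esub> b \<noteq> b"
    obtain j where j: "j \<in> I" "j \<noteq> i" using other by blast
    obtain a where "a \<in> carrier (G j)" "a \<noteq> \<one>\<^bsub>G j\<^esub>"
      using nonidentity_element[OF j(1) nontrivial[OF j(1)]] .
    with i b j fin not_finite_C_width_if_noninvolution show False by blast
  qed
  obtain i j where ij: "i \<in> I" "j \<in> I" "i \<noteq> j" using two by blast
  have "I = {i, j}"
  proof (rule ccontr)
    assume "I \<noteq> {i, j}"
    then obtain k where k: "k \<in> I" "i \<noteq> k" "j \<noteq> k" using ij by blast
    obtain x where x: "x \<in> carrier (G i)" "x \<noteq> \<one>\<^bsub>G i\<^esub>"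
      using nonidentity_element[OF ij(1) nontrivial[OF ij(1)]] .
    obtain y where y: "y \<in> carrier (G j)" "y \<noteq> \<one>\<^bsub>G j\<^esub>"
      using nonidentity_element[OF ij(2) nontrivial[OF ij(2)]] .
    obtain z where z: "z \<in> carrier (G k)" "z \<noteq> \<one>\<^bsub>G k\<^esub>"
      using nonidentity_element[OF k(1) nontrivial[OF k(1)]] .
    show False
      using not_finite_C_width_if_three_factors[OF ij(1,2) k(1) ij(3) k(2,3) x y z] fin by blast
  qed
  then have "card I = 2" using ij(3) by simp
  moreover have "order (G i) = 2" if i: "i \<in> I" for i
  proof (rule ccontr)
    assume order: "order (G i) \<noteq> 2"
    interpret group "G i" by (rule groups[OF i])
    obtain b where b: "b \<in> carrier (G i)" "b \<noteq> \<one>\<^bsub>G i\<^esub>"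
      using nonidentity_element[OF i nontrivial[OF i]] .
    have "carrier (G i) \<noteq> {\<one>\<^bsub>G i\<^esub>, b}" using order b(2) by (auto simp: order_def)
    then obtain c where c: "c \<in> carrier (G i)" "c \<noteq> \<one>\<^bsub>G i\<^esub>" "b \<noteq> c" using b by blast
    \<comment> \<open>A product of two distinct involutions supplies the third element of the cycle.\<close>
    let ?d = "b \<otimes>\<^bsub>G i\<^esub> c"
    have "?d \<noteq> \<one>\<^bsub>G i\<^esub>"
      using b c involutions[OF i c(1)] inv_equality[of b c] by auto
    moreover have "b \<noteq> ?d" "c \<noteq> ?d" using b c by auto
    moreover obtain j where j: "j \<in> I" "j \<noteq> i" using other by blast
    moreover obtain a where "a \<in> carrier (G j)" "a \<noteq> \<one>\<^bsub>G j\<^esub>"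
      using nonidentity_element[OF j(1) nontrivial[OF j(1)]] .
    ultimately show False
      using not_finite_C_width_if_two_involutions_and_third[of i j a b c ?d] fin b c i involutions by simp
  qed
  ultimately show ?thesis by blast
qed

section \<open>The infinite dihedral group\<close>

lemma count_in_inverse_word: "count_in J (inverse_word G w) = count_in J w"
  by (induction w) (auto simp: count_in_def)

lemma order_two_mult:
  assumes "i \<in> I" "order (G i) = 2" "g \<in> carrier (G i)" "g \<noteq> \<one>\<^bsub>G i\<^esub>"
    and "h \<in> carrier (G i)" "h \<noteq> \<one>\<^bsub>G i\<^esub>"
  shows "g = h" "g \<otimes>\<^bsub>G i\<^esub> h = \<one>\<^bsub>G i\<^esub>"
proof -
  interpret group "G i" by (rule groups[OF assms(1)])
  have eq: "x = g" if "x \<in> carrier (G i)" "x \<noteq> \<one>\<^bsub>G i\<^esub>" for x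
  proof -
    have "card (carrier (G i)) = 2" using assms(2) by (simp add: order_def)
    then obtain y z where "carrier (G i) = {y, z}" by (auto simp: card_2_iff)
    moreover from this have "\<one>\<^bsub>G i\<^esub> \<in> {y, z}" by (metis one_closed)
    ultimately show ?thesis using that assms(3,4) by auto
  qed
  show "g = h" using eq[OF assms(5,6)] by simp
  have "g \<otimes>\<^bsub>G i\<^esub> g \<noteq> g" using assms(3,4) by simp
  then show "g \<otimes>\<^bsub>G i\<^esub> h = \<one>\<^bsub>G i\<^esub>" using eq[of "g \<otimes>\<^bsub>G i\<^esub> g"] assms(3) \<open>g = h\<close> by auto
qed

context
  assumes order_two: "\<And>i. i \<in> I \<Longrightarrow> order (G i) = 2"
begin

lemma same_letter:
  assumes "(i, g) # u \<in> reduced_words I G" "(i, h) # v \<in> reduced_words I G"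
  shows "g = h" "g \<otimes>\<^bsub>G i\<^esub> h = \<one>\<^bsub>G i\<^esub>"
  using assms order_two_mult[OF _ order_two, of i g h] by (auto simp: reduced_words_Cons[OF groups])

text \<open>
  Parities of letter counts are homomorphisms: letters of the same factor coincide and have order two,
  so they never merge into a single letter but always cancel in pairs.
\<close>

lemma even_count_in_mult:
  assumes "u \<in> reduced_words I G" "v \<in> reduced_words I G"
  shows "even (count_in J (u \<otimes>\<^bsub>FP\<^esub> v)) \<longleftrightarrow> (even (count_in J u) \<longleftrightarrow> even (count_in J v))"
  using assms(1)
proof (induction u)
  case Nil
  then show ?case by (simp add: free_product_simps count_in_def)
next
  case (Cons x u)
  obtain i g where x: "x = (i, g)" by (cases x)
  have u: "u \<in> reduced_words I G" "g \<noteq> \<one>\<^bsub>G i\<^esub>"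
    using Cons.prems x by (auto simp: reduced_words_Cons[OF groups])
  let ?r = "u \<otimes>\<^bsub>FP\<^esub> v"
  have r: "?r \<in> reduced_words I G"
    using foldr_letter_mult_closed[OF groups u(1) assms(2)] by (simp add: free_product_simps)
  have "even (count_in J (letter_mult G x ?r)) \<longleftrightarrow> (fst x \<in> J \<longleftrightarrow> odd (count_in J ?r))"
  proof (cases "\<exists>h w. ?r = (i, h) # w")
    case True
    then obtain h w where w: "?r = (i, h) # w" by blast
    have "g \<otimes>\<^bsub>G i\<^esub> h = \<one>\<^bsub>G i\<^esub>" using same_letter(2)[of i g u h w] Cons.prems x r w by simp
    then show ?thesis using u(2) w x by (simp add: count_in_def)
  next
    case False
    then have "letter_mult G x ?r = x # ?r" using u(2) x by (cases ?r) auto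
    then show ?thesis by (simp add: count_in_def)
  qed
  then show ?case using Cons.IH[OF u(1)] by (auto simp: free_product_simps count_in_def)
qed

text \<open>
  Otherwise \<open>S\<close> would lie in the kernel of the parity homomorphism, a proper subgroup.
\<close>

lemma generating_set_ex_odd_count:
  assumes S: "generating_set FP S" and i: "i \<in> I" "i \<in> J"
  shows "\<exists>s\<in>S. odd (count_in J s)"
proof (rule ccontr)
  assume "\<not> (\<exists>s\<in>S. odd (count_in J s))"
  then have even_S: "\<And>s. s \<in> S \<Longrightarrow> even (count_in J s)" by blast
  have S_sub: "S \<subseteq> reduced_words I G" using S by (simp add: generating_set_def free_product_simps)
  have "w \<in> reduced_words I G \<and> even (count_in J w)" if "w \<in> generate FP S" for w
    using that
  proof induction
    case one
    then show ?case by (simp add: free_product_simps count_in_def reduced_words_Nil[OF groups])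
  next
    case (incl s)
    then show ?case using even_S S_sub by blast
  next
    case (inv s)
    moreover have "s \<in> reduced_words I G" using inv S_sub by blast
    ultimately show ?case
      using even_S by (simp add: inv_free_product inverse_word_closed count_in_inverse_word)
  next
    case (eng u v)
    then show ?case
      using even_count_in_mult[of u v J] FP.m_closed[of u v] by (simp add: free_product_simps)
  qed
  moreover have "\<not> carrier (G i) \<subseteq> {\<one>\<^bsub>G i\<^esub>}"
    using order_two[OF i(1)] card_mono[of "{\<one>\<^bsub>G i\<^esub>}" "carrier (G i)"] by (auto simp: order_def)
  then obtain g where "g \<in> carrier (G i)" "g \<noteq> \<one>\<^bsub>G i\<^esub>" by blast
  then have "[(i, g)] \<in> generate FP S"
    using S i by (simp add: generating_set_def free_product_simps
        reduced_words_Cons[OF groups] reduced_words_Nil[OF groups])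
  moreover have "odd (count_in J [(i, g)])" using i(2) by (simp add: count_in_def)
  ultimately show False by blast
qed

lemma odd_length_last_eq_hd:
  assumes "card I = 2" "w \<in> reduced_words I G" "odd (length w)"
  shows "fst (last w) = fst (hd w)"
  using assms(2,3)
proof (induction w rule: induct_list012)
  case (3 x y w)
  have "w \<noteq> []" using "3.prems"(2) by auto
  then have "fst (last w) = fst (hd w)" and "fst x \<in> I" "fst y \<in> I" "fst (hd w) \<in> I"
    and "fst x \<noteq> fst y" "fst (hd w) \<noteq> fst y"
    using 3 by (cases x; cases y; cases w; auto simp: reduced_words_Cons[OF groups])+
  with \<open>w \<noteq> []\<close> show ?case using \<open>card I = 2\<close> by (auto simp: card_2_iff)
qed auto

text \<open>
  With two letters only, the letters of a reduced word alternate, so a word of odd length is a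
  palindrome, that is, its middle letter conjugated by its first half.
\<close>

lemma odd_length_conjugate_letter:
  assumes two: "card I = 2" and "w \<in> reduced_words I G" "odd (length w)"
  shows "\<exists>u\<in>carrier FP. \<exists>x. [x] \<in> carrier FP \<and> w = u \<otimes>\<^bsub>FP\<^esub> [x] \<otimes>\<^bsub>FP\<^esub> inv\<^bsub>FP\<^esub> u"
  using assms(2,3)
proof (induction "length w" arbitrary: w rule: less_induct)
  case less
  show ?case
  proof (cases "length w = 1")
    case True
    then obtain x where w: "w = [x]" by (auto simp: length_Suc_conv)
    then have "[x] \<in> carrier FP" using less.prems(1) by (simp add: free_product_simps(1))
    then have "w = \<one>\<^bsub>FP\<^esub> \<otimes>\<^bsub>FP\<^esub> [x] \<otimes>\<^bsub>FP\<^esub> inv\<^bsub>FP\<^esub> \<one>\<^bsub>FP\<^esub>" using w by simp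
    then show ?thesis using \<open>[x] \<in> carrier FP\<close> by blast
  next
    case False
    with less.prems(2) obtain x v y where w: "w = x # v @ [y]"
      by (metis append_butlast_last_id length_0_conv length_Cons list.exhaust One_nat_def even_zero)
    have v: "v \<in> reduced_words I G" "odd (length v)" "length v < length w"
      and xy: "[x] \<in> reduced_words I G" "[y] \<in> reduced_words I G"
      using less.prems reduced_words_append[of "[x]" "v @ [y]"] reduced_words_append[of v "[y]"]
      by (auto simp: w)
    have "fst y = fst x" using odd_length_last_eq_hd[OF two less.prems] by (simp add: w)
    then have yx: "y = x" using xy same_letter(1)[of "fst x" "snd x" "[]" "snd y" "[]"] by (cases x; cases y) simp
    have inv_x: "inv\<^bsub>FP\<^esub> [x] = [x]"
      using xy same_letter(2)[of "fst x" "snd x" "[]" "snd x" "[]"]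
      by (intro FP.inv_equality; cases x)
        (auto simp: free_product_simps reduced_words_Cons[OF groups])
    obtain u c where u: "u \<in> carrier FP" "[c] \<in> carrier FP" "v = u \<otimes>\<^bsub>FP\<^esub> [c] \<otimes>\<^bsub>FP\<^esub> inv\<^bsub>FP\<^esub> u"
      using less.hyps[OF v(3,1,2)] by blast
    have x: "[x] \<in> carrier FP" using xy by (simp add: free_product_simps)
    have "w = [x] \<otimes>\<^bsub>FP\<^esub> (v \<otimes>\<^bsub>FP\<^esub> [x])"
      using mult_reduced_append[of "[x]" "v @ [x]"] mult_reduced_append[of v "[x]"] less.prems(1)
        reduced_words_append[of "[x]" "v @ [x]"]
      by (simp add: w yx)
    also have "\<dots> = [x] \<otimes>\<^bsub>FP\<^esub> (v \<otimes>\<^bsub>FP\<^esub> inv\<^bsub>FP\<^esub> [x])" by (simp only: inv_x)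
    also have "\<dots> = ([x] \<otimes>\<^bsub>FP\<^esub> u) \<otimes>\<^bsub>FP\<^esub> [c] \<otimes>\<^bsub>FP\<^esub> inv\<^bsub>FP\<^esub> ([x] \<otimes>\<^bsub>FP\<^esub> u)"
      unfolding u(3) using u(1,2) x by (simp only: FP.inv_mult_group FP.m_assoc FP.m_closed FP.inv_closed)
    finally show ?thesis using u(1,2) x by blast
  qed
qed

text \<open>
  Conjugation invariance puts all conjugates of one letter into \<open>S\<close>. These reach the kernel of the
  parity of the other letter in two steps, and one more generator reaches the other coset of the kernel.
\<close>

lemma infinite_dihedral_finite_C_width:
  assumes two: "card I = 2"
  shows "finite_C_width FP"
  unfolding finite_C_width_def
proof (intro allI impI)
  fix S assume "generating_set FP S \<and> conjugation_invariant FP S"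
  then have gen: "generating_set FP S" and S: "S \<subseteq> carrier FP"
    and conj: "\<And>g s. g \<in> carrier FP \<Longrightarrow> s \<in> S \<Longrightarrow> g \<otimes>\<^bsub>FP\<^esub> s \<otimes>\<^bsub>FP\<^esub> inv\<^bsub>FP\<^esub> g \<in> S"
    using FP.conjugation_invariant_iff by (auto simp: generating_set_def)
  have carrier: "w \<in> carrier FP \<longleftrightarrow> w \<in> reduced_words I G" for w by (simp add: free_product_simps)
  obtain s0 where s0: "s0 \<in> S" "odd (count_in UNIV s0)"
    using generating_set_ex_odd_count[OF gen, of _ UNIV] two by fastforce
  obtain u x where u: "u \<in> carrier FP" and x: "[x] \<in> carrier FP"
    and s0_eq: "s0 = u \<otimes>\<^bsub>FP\<^esub> [x] \<otimes>\<^bsub>FP\<^esub> inv\<^bsub>FP\<^esub> u"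
  proof -
    have "s0 \<in> reduced_words I G" "odd (length s0)"
      using s0 S carrier by (auto simp: count_in_def)
    then show thesis using odd_length_conjugate_letter[OF two, of s0] that by blast
  qed
  have "inv\<^bsub>FP\<^esub> u \<otimes>\<^bsub>FP\<^esub> s0 \<otimes>\<^bsub>FP\<^esub> inv\<^bsub>FP\<^esub> (inv\<^bsub>FP\<^esub> u) \<in> S"
    by (intro conj[OF _ s0(1)] FP.inv_closed u)
  also have "inv\<^bsub>FP\<^esub> u \<otimes>\<^bsub>FP\<^esub> s0 \<otimes>\<^bsub>FP\<^esub> inv\<^bsub>FP\<^esub> (inv\<^bsub>FP\<^esub> u) = [x]"
    unfolding s0_eq using u x by (simp add: FP.inv_solve_left' FP.m_assoc)
  finally have x_S: "[x] \<in> S" .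
  obtain i a where xi: "x = (i, a)" by (cases x)
  have "i \<in> I" using x xi by (simp add: carrier reduced_words_Cons[OF groups])
  then obtain j where j: "j \<noteq> i" "I = {i, j}" using two by (metis card_2_iff insertE insert_commute singletonD)
  obtain s where s: "s \<in> S" "odd (count_in {j} s)"
    using generating_set_ex_odd_count[OF gen, of j "{j}"] j(2) by blast
  \<comment> \<open>Such an element is a conjugate of a letter, and the parity excludes the letter of factor \<open>j\<close>.\<close>
  have reflection: "g \<in> S"
    if g: "g \<in> carrier FP" "odd (length g)" "even (count_in {j} g)" for g
  proof -
    obtain v y where v: "v \<in> carrier FP" "[y] \<in> carrier FP" "g = v \<otimes>\<^bsub>FP\<^esub> [y] \<otimes>\<^bsub>FP\<^esub> inv\<^bsub>FP\<^esub> v"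
      using odd_length_conjugate_letter[OF two, of g] g carrier by auto
    have "even (count_in {j} (inv\<^bsub>FP\<^esub> v)) = even (count_in {j} v)"
      using v(1) by (simp add: carrier inv_free_product count_in_inverse_word)
    then have "even (count_in {j} g) = even (count_in {j} [y])"
      using v even_count_in_mult[of "v \<otimes>\<^bsub>FP\<^esub> [y]" "inv\<^bsub>FP\<^esub> v"] even_count_in_mult[of v "[y]"]
        FP.m_closed FP.inv_closed unfolding carrier[symmetric] by auto
    then have "fst y \<noteq> j" using g(3) by (auto simp: count_in_def)
    moreover have "fst y \<in> I"
      using v(2) by (cases y) (simp add: carrier reduced_words_Cons[OF groups])
    ultimately have "fst y = i" using j(2) by blast
    then have "y = x" using same_letter(1)[of i "snd y" "[]" a "[]"] v(2) x xi by (cases y) (simp add: carrier)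
    then show ?thesis using conj[OF v(1) x_S] v(3) by simp
  qed
  \<comment> \<open>An element of even length turns into one of the previous kind when multiplied by \<open>x\<close>.\<close>
  have even_case: "\<exists>xs. length xs \<le> 2 \<and> set xs \<subseteq> S \<and> foldr (\<otimes>\<^bsub>FP\<^esub>) xs \<one>\<^bsub>FP\<^esub> = g"
    if g: "g \<in> carrier FP" "even (count_in {j} g)" for g
  proof (cases "odd (length g)")
    case True
    then have "g \<in> S" using reflection g by blast
    then show ?thesis using g(1) by (intro exI[of _ "[g]"]) simp
  next
    case False
    have "even (count_in UNIV (g \<otimes>\<^bsub>FP\<^esub> [x])) \<longleftrightarrow> (even (count_in UNIV g) \<longleftrightarrow> even (count_in UNIV [x]))"
      and "even (count_in {j} (g \<otimes>\<^bsub>FP\<^esub> [x])) \<longleftrightarrow> (even (count_in {j} g) \<longleftrightarrow> even (count_in {j} [x]))"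
      using g(1) x even_count_in_mult by (auto simp: carrier)
    then have "odd (length (g \<otimes>\<^bsub>FP\<^esub> [x]))" "even (count_in {j} (g \<otimes>\<^bsub>FP\<^esub> [x]))"
      using False g(2) xi j(1) by (auto simp: count_in_def)
    then have gx: "g \<otimes>\<^bsub>FP\<^esub> [x] \<in> S" using reflection g(1) x by simp
    have "[x] \<otimes>\<^bsub>FP\<^esub> [x] = \<one>\<^bsub>FP\<^esub>"
      using same_letter(2)[of i a "[]" a "[]"] x xi by (auto simp: free_product_simps reduced_words_Cons[OF groups])
    then have "g \<otimes>\<^bsub>FP\<^esub> [x] \<otimes>\<^bsub>FP\<^esub> [x] = g" using g(1) x by (simp add: FP.m_assoc)
    then show ?thesis using gx x_S x by (intro exI[of _ "[g \<otimes>\<^bsub>FP\<^esub> [x], [x]]"]) simp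
  qed
  have "\<exists>xs. length xs \<le> 3 \<and> set xs \<subseteq> S \<and> foldr (\<otimes>\<^bsub>FP\<^esub>) xs \<one>\<^bsub>FP\<^esub> = g" if g: "g \<in> carrier FP" for g
  proof (cases "even (count_in {j} g)")
    case True
    then obtain xs where "length xs \<le> 2" "set xs \<subseteq> S" "foldr (\<otimes>\<^bsub>FP\<^esub>) xs \<one>\<^bsub>FP\<^esub> = g"
      using even_case[OF g] by blast
    then show ?thesis by (intro exI[of _ xs]) simp
  next
    case False
    have s_FP: "s \<in> carrier FP" using s(1) S by blast
    have "even (count_in {j} (inv\<^bsub>FP\<^esub> s)) = even (count_in {j} s)"
      using s_FP by (simp add: carrier inv_free_product count_in_inverse_word)
    then have "even (count_in {j} (inv\<^bsub>FP\<^esub> s \<otimes>\<^bsub>FP\<^esub> g))"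
      using even_count_in_mult[of "inv\<^bsub>FP\<^esub> s" g "{j}"] FP.inv_closed[OF s_FP] g s(2) False
      unfolding carrier by blast
    then obtain xs where xs: "length xs \<le> 2" "set xs \<subseteq> S"
      "foldr (\<otimes>\<^bsub>FP\<^esub>) xs \<one>\<^bsub>FP\<^esub> = inv\<^bsub>FP\<^esub> s \<otimes>\<^bsub>FP\<^esub> g"
      using even_case[of "inv\<^bsub>FP\<^esub> s \<otimes>\<^bsub>FP\<^esub> g"] g s_FP by auto
    have "foldr (\<otimes>\<^bsub>FP\<^esub>) (s # xs) \<one>\<^bsub>FP\<^esub> = g"
      using xs(3) s_FP g by (simp add: FP.m_assoc[symmetric])
    then show ?thesis using xs(1,2) s(1) by (intro exI[of _ "s # xs"]) simp
  qed
  then show "wid FP S < \<infinity>" unfolding FP.wid_finite_iff[OF gen] by blast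
qed

end

end

theorem proposition3p3:
  fixes I :: "'i set" and G :: "'i \<Rightarrow> ('a, 'b) monoid_scheme"
  assumes "\<And>i. i \<in> I \<Longrightarrow> group (G i)"
    and "\<And>i. i \<in> I \<Longrightarrow> \<not> trivial_group (G i)"
    and "\<exists>i\<in>I. \<exists>j\<in>I. i \<noteq> j"
  shows "finite_C_width (free_product I G) \<longleftrightarrow> card I = 2 \<and> (\<forall>i\<in>I. order (G i) = 2)"
proof
  assume "finite_C_width (free_product I G)"
  then show "card I = 2 \<and> (\<forall>i\<in>I. order (G i) = 2)"
    using finite_C_width_imp_infinite_dihedral[of I G] assms by blast
next
  assume "card I = 2 \<and> (\<forall>i\<in>I. order (G i) = 2)"
  then show "finite_C_width (free_product I G)"
    using infinite_dihedral_finite_C_width[of I G] assms(1) by blast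
qed

end
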